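(* For $\lambda\ge 0$ consider the boundary value problem $$r^2w''(r)-rw'(r)=\frac{\lambda}{2}r^4+\frac{w^2(r)}{2}\quad\text{for } r\in(0,1],\qquad \lim_{r\to 0_+}w'(r)=0,\qquad w(1)=w'(1). \qquad (N_\lambda)$$ Let $\lambda_0>0$ be the real number such that $(N_\lambda)$ is solvable for every $\lambda\in[0,\lambda_0)$ and has no solution for $\lambda>\lambda_0$ (such a number exists). Then $$9\le\lambda_0\le \frac{128}{11}.$$
   Context: A solution is a real-valued function $w:(0,1]\to\mathbb{R}$ which is of class $C^2$ on every compact interval $[a,b]\subseteq(0,1]$ (one-sided derivatives at the endpoint $r=1$), satisfies the differential equation for all $r\in(0,1]$ and satisfies the stated conditions. Under the substitution $t=r^2/2$, $u(t)=w(r)$ the problem is equivalent to $u''=\frac{u^2}{8t^2}+\frac{\lambda}{2}$ on $(0,1/2]$, $\lim_{t\to0_+}\sqrt{t}\,u'(t)=0$, $u(1/2)=u'(1/2)$. *)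

theory Defs
  imports Complex_Main
begin

definition C2_on_with ::
    "real set \<Rightarrow> (real \<Rightarrow> real) \<Rightarrow> (real \<Rightarrow> real) \<Rightarrow> (real \<Rightarrow> real) \<Rightarrow> bool" where
  "C2_on_with S w w' w'' \<longleftrightarrow>
     (\<forall>r\<in>S. (w has_real_derivative w' r) (at r within S)) \<and>
     (\<forall>r\<in>S. (w' has_real_derivative w'' r) (at r within S)) \<and>
     continuous_on S w''"

(* A solution is a function on (0,1]; its values outside (0,1] are irrelevant.
   The endpoints a < b keep the one-sided derivatives on {a..b} meaningful and make
   w' and w'' unique on (0,1]; at r = 1 they are left-sided derivatives. *)
definition solves_N :: "real \<Rightarrow> (real \<Rightarrow> real) \<Rightarrow> bool" where
  "solves_N lam w \<longleftrightarrow>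
     (\<exists>w' w''.
        (\<forall>a b. 0 < a \<and> a < b \<and> b \<le> 1 \<longrightarrow> C2_on_with {a..b} w w' w'') \<and>
        (\<forall>r\<in>{0<..1}. r\<^sup>2 * w'' r - r * w' r = lam / 2 * r ^ 4 + (w r)\<^sup>2 / 2) \<and>
        (w' \<longlongrightarrow> 0) (at_right 0) \<and>
        w 1 = w' 1)"

definition N_solvable :: "real \<Rightarrow> bool" where
  "N_solvable lam \<longleftrightarrow> (\<exists>w. solves_N lam w)"

end

theory Submission
  imports Defs "HOL-Analysis.Equivalence_Lebesgue_Henstock_Integration"
begin

text \<open>
  Put \<open>t = r\<^sup>2 / 2\<close> and \<open>u t = w r\<close>, so that \<open>u'' = u\<^sup>2 / (8 t\<^sup>2) + lam / 2\<close> with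
  \<open>u (1/2) = u' (1/2)\<close>. One function, \<open>\<phi> = r\<^sup>2 - r\<^sup>3 / 2\<close>, yields both bounds: it vanishes at \<open>0\<close>,
  satisfies the boundary condition at \<open>t = 1/2\<close>, and its second \<open>t\<close>-derivative is
  \<open>- 3 / (2 r)\<close>.

  For the upper bound, \<open>\<phi>\<close> is a test function. Integration by parts gives
  \<open>0 = \<integral> (\<phi> u\<^sup>2 / (8 t\<^sup>2) - \<phi>'' u + lam / 2 \<phi>) dt\<close>
  up to a boundary term at \<open>0\<close>. Completing the square in \<open>u\<close> bounds the integrand below by
  \<open>lam / 2 \<phi> - 2 t\<^sup>2 \<phi>''\<^sup>2 / \<phi>\<close>, and the resulting
  inequality is \<open>lam \<le> 60 ln 2 - 30 < 128 / 11\<close>. The boundary term has the right sign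
  because \<open>w\<close> cannot stay above a positive constant near \<open>0\<close> (lemma
  \<open>values_small_near_zero\<close>). In \<open>solvable_imp_le\<close> the integral is replaced by a monotone
  function of \<open>r\<close>.

  For the lower bound, \<open>6 \<phi>\<close> is a barrier for \<open>v = - u\<close>: it is a supersolution of
  \<open>- v'' = v\<^sup>2 / (8 t\<^sup>2) + lam / 2\<close> exactly when \<open>9 (1 - r)\<^sup>2 (2 - r) + (9 - lam) r \<ge> 0\<close>
  on \<open>(0, 1]\<close>, in particular for \<open>lam \<le> 9\<close> (lemma \<open>barrier_inequality\<close>). The Green function of
  the linear problem is nonnegative, so the iteration that starts from \<open>0\<close> increases and stays
  below the barrier, and its limit gives a solution (lemmas \<open>profile_fixed_point\<close> and
  \<open>solvable_if_le\<close>).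
\<close>

section \<open>Nonexistence for large parameters\<close>

text \<open>The value \<open>229/330\<close> is exactly what turns \<open>60 ln 2 - 30\<close> into \<open>128/11\<close>. The margin is below
  \<open>1/1000\<close>, hence the splitting of the exponent into sixteen parts before the quadratic
  Taylor bound is used.\<close>

lemma ln2_le: "ln (2::real) \<le> 229 / 330"
proof -
  let ?y = "229 / 5280 :: real"
  have "2 \<le> (1 + ?y + ?y\<^sup>2 / 2) ^ 16"
    by (simp add: power2_eq_square field_simps)
  also have "\<dots> \<le> exp ?y ^ 16"
    by (intro power_mono exp_lower_Taylor_quadratic) auto
  also have "\<dots> = exp (229 / 330)"
    by (simp flip: exp_of_nat_mult)
  finally show ?thesis
    by (simp flip: ln_le_cancel_iff[of 2 "exp (229 / 330)"])
qed

text \<open>A form of \<open>w 0 \<le> 0\<close> that avoids showing that the limit of \<open>w\<close> at \<open>0\<close> exists. By the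
  equation, \<open>(w' / r)' \<ge> w\<^sup>2 / (2 r\<^sup>3)\<close>. If \<open>w \<ge> \<epsilon>\<close> near \<open>0\<close>, integration gives
  \<open>w' \<le> C r - \<epsilon>\<^sup>2 / (4 r)\<close> there, which contradicts \<open>w' \<longlongrightarrow> 0\<close>.\<close>

lemma values_small_near_zero:
  assumes d2: "\<And>r. r \<in> {0<..<1} \<Longrightarrow> (w' has_real_derivative w'' r) (at r)"
    and ode: "\<And>r. r \<in> {0<..<1} \<Longrightarrow> r\<^sup>2 * w'' r - r * w' r = lam / 2 * r ^ 4 + (w r)\<^sup>2 / 2"
    and lim: "(w' \<longlongrightarrow> 0) (at_right 0)"
    and "0 \<le> lam" "0 < \<epsilon>" "0 < \<delta>"
  shows "\<exists>r\<in>{0<..<\<delta>}. w r < \<epsilon>"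
proof (rule ccontr)
  assume "\<not> ?thesis"
  then have large: "\<epsilon> \<le> w r" if "r \<in> {0<..<\<delta>}" for r using that by force
  define b where "b = min \<delta> 1 / 2"
  have b: "0 < b" "b < \<delta>" "b < 1" using assms by (auto simp: b_def)
  define G where "G r = w' r / r + \<epsilon>\<^sup>2 / (4 * r\<^sup>2)" for r
  have dG: "(G has_real_derivative (r\<^sup>2 * w'' r - r * w' r - \<epsilon>\<^sup>2 / 2) / r ^ 3) (at r)" if "r \<in> {0<..<1}" for r
    unfolding G_def using that
    by (auto intro!: derivative_eq_intros d2 simp: field_simps power2_eq_square power3_eq_cube)
  have G_mono: "G r \<le> G b" if r: "r \<in> {0<..<b}" for r
  proof (rule DERIV_nonneg_imp_increasing_open[where f = G])
    fix x assume x: "r < x" "x < b"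
    then have x': "x \<in> {0<..<1}" "x \<in> {0<..<\<delta>}" using r b by auto
    have "\<epsilon>\<^sup>2 \<le> (w x)\<^sup>2"
      using large[OF x'(2)] \<open>0 < \<epsilon>\<close> by (intro power_mono) auto
    moreover have "0 \<le> lam / 2 * x ^ 4" using \<open>0 \<le> lam\<close> by simp
    ultimately have "0 \<le> x\<^sup>2 * w'' x - x * w' x - \<epsilon>\<^sup>2 / 2"
      unfolding ode[OF x'(1)] by linarith
    then have "0 \<le> (x\<^sup>2 * w'' x - x * w' x - \<epsilon>\<^sup>2 / 2) / x ^ 3"
      using x'(1) by (intro divide_nonneg_nonneg) auto
    then show "\<exists>y. (G has_real_derivative y) (at x) \<and> 0 \<le> y"
      using dG[OF x'(1)] by blast
  next
    show "continuous_on {r..b} G"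
      using r b by (auto intro!: DERIV_continuous_on has_field_derivative_at_within[OF dG])
  qed (use r in auto)
  have "((\<lambda>r. r * w' r - r\<^sup>2 * G b) \<longlongrightarrow> 0 * 0 - 0\<^sup>2 * G b) (at_right 0)"
    by (intro tendsto_intros lim)
  moreover have "\<forall>\<^sub>F r in at_right 0. r * w' r - r\<^sup>2 * G b \<le> - (\<epsilon>\<^sup>2 / 4)"
  proof -
    have "r * w' r - r\<^sup>2 * G b \<le> - (\<epsilon>\<^sup>2 / 4)" if r: "r \<in> {0<..<b}" for r
    proof -
      have "r * w' r + \<epsilon>\<^sup>2 / 4 = r\<^sup>2 * G r"
        using r by (simp add: G_def field_simps power2_eq_square)
      also have "\<dots> \<le> r\<^sup>2 * G b" by (intro mult_left_mono G_mono r) auto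
      finally show ?thesis by simp
    qed
    then show ?thesis using b by (auto simp: eventually_at_right_field)
  qed
  ultimately have "0 * 0 - 0\<^sup>2 * G b \<le> - (\<epsilon>\<^sup>2 / 4)"
    by (intro tendsto_upperbound) auto
  moreover have "0 < \<epsilon>\<^sup>2" using \<open>0 < \<epsilon>\<close> by simp
  ultimately show False by simp
qed

text \<open>The bound obtained is \<open>60 ln 2 - 30\<close>, about \<open>11.589\<close>; the function \<open>H\<close> below is the integrated
  form of testing the equation with \<open>\<phi> = r\<^sup>2 - r\<^sup>3 / 2\<close> and completing the square in \<open>w\<close>.\<close>

lemma solvable_imp_le:
  assumes "N_solvable lam" and lam: "0 \<le> lam"
  shows "lam \<le> 128 / 11"
proof -
  from assms obtain w w' w'' where
    C2: "\<And>a. 0 < a \<Longrightarrow> a < 1 \<Longrightarrow> C2_on_with {a..1} w w' w''" and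
    ode: "\<And>r. r \<in> {0<..1} \<Longrightarrow> r\<^sup>2 * w'' r - r * w' r = lam / 2 * r ^ 4 + (w r)\<^sup>2 / 2" and
    lim: "(w' \<longlongrightarrow> 0) (at_right 0)" and bc: "w 1 = w' 1"
    unfolding N_solvable_def solves_N_def by (metis order_refl)
  have interior: "at r within {r / 2..1} = at r" if "r \<in> {0<..<1}" for r :: real
    using that by (intro at_within_Icc_at) auto
  have d1: "(w has_real_derivative w' r) (at r)" and d2: "(w' has_real_derivative w'' r) (at r)"
    if "r \<in> {0<..<1}" for r
    using C2[of "r / 2"] that unfolding C2_on_with_def
    by (auto simp flip: interior[OF that])
  have cont: "continuous_on {a..1} w" "continuous_on {a..1} w'" if "0 < a" "a < 1" for a
    using C2[OF that] by (auto simp: C2_on_with_def intro: DERIV_continuous_on)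
  (* H is the Wronskian phi u_t - phi_t u, where u_t = w' / r and phi = r^2 - r^3 / 2, minus an
     antiderivative of lam / 2 * r phi, plus one of 9 r / (4 (2 - r)), the term that completes
     the square in w. R is the part of H that has a limit at 0 without any control of w. *)
  define R where "R r = (r - r\<^sup>2 / 2) * w' r - lam / 2 * (r ^ 4 / 4 - r ^ 5 / 10) - 9 / 4 * (r + 2 * ln (2 - r))" for r
  define H where "H r = R r - (2 - 3 * r / 2) * w r" for r
  have dH: "(H has_real_derivative ((2 - r) * w r + 3 * r)\<^sup>2 / (4 * r * (2 - r))) (at r)"
    if r: "r \<in> {0<..<1}" for r
  proof -
    have "(H has_real_derivative
        (1 - r) * w' r + (r - r\<^sup>2 / 2) * w'' r - lam / 2 * (r ^ 3 - r ^ 4 / 2) - 9 / 4 * (1 - 2 / (2 - r))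
          - ((2 - 3 * r / 2) * w' r - 3 / 2 * w r)) (at r)"
      unfolding H_def R_def using r
      by (auto intro!: derivative_eq_intros d1 d2 simp: field_simps)
    moreover have "(1 - r) * w' r + (r - r\<^sup>2 / 2) * w'' r - lam / 2 * (r ^ 3 - r ^ 4 / 2) - 9 / 4 * (1 - 2 / (2 - r))
          - ((2 - 3 * r / 2) * w' r - 3 / 2 * w r) = ((2 - r) * w r + 3 * r)\<^sup>2 / (4 * r * (2 - r))"
    proof -
      have w'': "w'' r = (lam / 2 * r ^ 4 + (w r)\<^sup>2 / 2 + r * w' r) / r\<^sup>2"
        using ode[of r] r by (simp add: field_simps)
      show ?thesis
        unfolding w'' using r by (simp add: divide_simps) (simp add: algebra_simps power_numeral_reduce)
    qed
    ultimately show ?thesis by simp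
  qed
  have H_mono: "H r \<le> H 1" if r: "r \<in> {0<..<1}" for r
  proof (rule DERIV_nonneg_imp_increasing_open[where f = H])
    fix x assume "r < x" "x < 1"
    then have x: "x \<in> {0<..<1}" using r by auto
    then have "0 \<le> ((2 - x) * w x + 3 * x)\<^sup>2 / (4 * x * (2 - x))" by simp
    then show "\<exists>y. (H has_real_derivative y) (at x) \<and> 0 \<le> y" using dH[OF x] by blast
  next
    show "continuous_on {r..1} H"
      unfolding H_def R_def using r by (auto intro!: continuous_intros cont)
  qed (use r in auto)
  (* The Wronskian vanishes at 1, since phi, like u, equals its t-derivative there. *)
  have H1: "H 1 = - (3 / 40) * lam - 9 / 4"
    by (simp add: H_def R_def bc algebra_simps)
  have "(R \<longlongrightarrow> (0 - 0\<^sup>2 / 2) * 0 - lam / 2 * (0 ^ 4 / 4 - 0 ^ 5 / 10) - 9 / 4 * (0 + 2 * ln (2 - 0))) (at_right 0)"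
    unfolding R_def by (intro tendsto_intros lim) auto
  then have R_lim: "(R \<longlongrightarrow> - (9 / 2) * ln 2) (at_right 0)" by simp
  have "- (9 / 2) * ln 2 \<le> H 1 + \<epsilon>" if \<epsilon>: "0 < \<epsilon>" for \<epsilon>
  proof -
    have "\<forall>\<^sub>F r in at_right 0. - (9 / 2) * ln 2 - \<epsilon> / 3 < R r"
      using R_lim \<epsilon> by (intro order_tendstoD) auto
    then obtain d where d: "d > 0" "\<And>r. r \<in> {0<..<d} \<Longrightarrow> - (9 / 2) * ln 2 - \<epsilon> / 3 < R r"
      by (auto simp: eventually_at_right_field)
    obtain r where r: "r \<in> {0<..<min d 1}" "w r < \<epsilon> / 3"
      using values_small_near_zero[of w' w'' lam w "\<epsilon> / 3" "min d 1", OF d2 ode lim lam]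
        \<epsilon> d(1) by auto
    have "(2 - 3 * r / 2) * w r \<le> (2 - 3 * r / 2) * (\<epsilon> / 3)"
      using r by (intro mult_left_mono) auto
    also have "\<dots> \<le> 2 * (\<epsilon> / 3)"
      using r \<epsilon> by (intro mult_right_mono) auto
    finally show ?thesis
      using d(2)[of r] H_mono[of r] r unfolding H_def[of r] by simp
  qed
  then have "- (9 / 2) * ln 2 \<le> H 1" by (rule field_le_epsilon)
  then show ?thesis using ln2_le H1 by simp
qed

section \<open>The Green kernel and the barrier\<close>

text \<open>In the variable \<open>t = r\<^sup>2 / 2\<close>, the Green function of \<open>- v'' = f\<close> with \<open>v 0 = 0\<close> and
  \<open>v (1/2) = v' (1/2)\<close> is \<open>min s t + 2 * t * s\<close>. The kernel is its quotient by \<open>t\<close>, so that it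
  produces the profile \<open>p = v / t\<close>. The singular term \<open>v\<^sup>2 / (8 t\<^sup>2)\<close> becomes the regular
  \<open>p\<^sup>2 / 8\<close>. At \<open>s = 0\<close> the kernel vanishes for every \<open>t \<ge> 0\<close>, also for \<open>t = 0\<close>, where
  \<open>0 / 0 = 0\<close>.\<close>

definition profile_kernel :: "real \<Rightarrow> real \<Rightarrow> real" where
  "profile_kernel t s = (if s \<le> t then s / t else 1) + 2 * s"

lemma profile_kernel_bounds:
  assumes "t \<in> {0..1/2}" "s \<in> {0..1/2}"
  shows "0 \<le> profile_kernel t s" "profile_kernel t s \<le> 2"
proof -
  have "s / t \<le> 1" if "s \<le> t"
    using that assms by (cases "t = 0") (auto simp: divide_le_eq_1)
  then show "profile_kernel t s \<le> 2"
    using assms by (auto simp: profile_kernel_def)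
qed (use assms in \<open>auto simp: profile_kernel_def\<close>)

text \<open>Continuity in \<open>t\<close> for fixed \<open>s\<close> extends to \<open>t = 0\<close>, although the convergence
  is not uniform in \<open>s\<close> there.\<close>

lemma profile_kernel_tendsto:
  assumes "\<And>n. x n \<in> {0..1/2}" "x \<longlonglongrightarrow> t" "t \<in> {0..1/2}" "s \<in> {0..1/2}"
  shows "(\<lambda>n. profile_kernel (x n) s) \<longlonglongrightarrow> profile_kernel t s"
proof (cases "t = 0")
  case True
  show ?thesis
  proof (cases "s = 0")
    case True
    then show ?thesis using assms(1) \<open>t = 0\<close> by (simp add: profile_kernel_def)
  next
    case False
    then have "\<forall>\<^sub>F n in sequentially. x n < s"
      using assms True by (intro order_tendstoD) auto
    then have "\<forall>\<^sub>F n in sequentially. profile_kernel (x n) s = profile_kernel t s"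
      by eventually_elim (use True False assms in \<open>auto simp: profile_kernel_def\<close>)
    then show ?thesis by (rule tendsto_eventually)
  qed
next
  case False
  then have t: "t > 0" using assms by auto
  have eq: "profile_kernel y s = min (s / y) 1 + 2 * s" if "y > 0" for y
    using that by (auto simp: profile_kernel_def min_def divide_simps)
  have "\<forall>\<^sub>F n in sequentially. x n > 0"
    using assms t by (intro order_tendstoD) auto
  then have "\<forall>\<^sub>F n in sequentially. min (s / x n) 1 + 2 * s = profile_kernel (x n) s"
    by eventually_elim (simp add: eq)
  moreover have "(\<lambda>n. min (s / x n) 1 + 2 * s) \<longlonglongrightarrow> min (s / t) 1 + 2 * s"
    using assms t by (intro tendsto_intros) auto
  ultimately show ?thesis using t by (simp add: eq Lim_transform_eventually)
qed

lemma profile_kernel_integrable: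
  assumes "continuous_on {0..1/2} f" "t \<in> {0..1/2}"
  shows "(\<lambda>s. profile_kernel t s * f s) integrable_on {0..1/2}"
proof -
  let ?g = "\<lambda>s. ((if t = 0 then 1 else min (s / t) 1) + 2 * s) * f s"
  have "continuous_on {0..1/2} ?g"
    by (cases "t = 0") (auto intro!: continuous_intros assms)
  then have "?g integrable_on {0..1/2}"
    by (rule integrable_continuous_interval)
  moreover have "negligible {0::real}" by simp
  ultimately show ?thesis
    by (rule integrable_spike) (use assms(2) in \<open>auto simp: profile_kernel_def min_def divide_simps\<close>)
qed

text \<open>Integrability is assumed against the kernel instead of being derived from continuity of \<open>f\<close>,
  because \<open>f\<close> may be the monotone limit whose continuity this lemma is to establish.\<close>

lemma profile_integral_continuous:
  fixes f :: "real \<Rightarrow> real"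
  assumes int: "\<And>t. t \<in> {0..1/2} \<Longrightarrow> (\<lambda>s. profile_kernel t s * f s) integrable_on {0..1/2}"
    and f: "\<And>s. s \<in> {0..1/2} \<Longrightarrow> 0 \<le> f s \<and> f s \<le> C"
  shows "continuous_on {0..1/2} (\<lambda>t. integral {0..1/2} (\<lambda>s. profile_kernel t s * f s))"
proof (rule continuous_on_sequentiallyI)
  fix x t assume x: "\<forall>n. x n \<in> {0..1/2::real}" "t \<in> {0..1/2}" "x \<longlonglongrightarrow> t"
  show "(\<lambda>n. integral {0..1/2} (\<lambda>s. profile_kernel (x n) s * f s))
          \<longlonglongrightarrow> integral {0..1/2} (\<lambda>s. profile_kernel t s * f s)"
  proof (rule dominated_convergence(2)[where h = "\<lambda>s. 2 * C"])
    fix n s assume s: "s \<in> {0..1/2::real}"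
    have "profile_kernel (x n) s * f s \<le> 2 * C"
      using profile_kernel_bounds[of "x n" s] x f[OF s] s by (intro mult_mono) auto
    moreover have "0 \<le> profile_kernel (x n) s * f s"
      using profile_kernel_bounds[of "x n" s] x f[OF s] s by simp
    ultimately show "norm (profile_kernel (x n) s * f s) \<le> 2 * C" by simp
  qed (use x int in \<open>auto intro!: tendsto_intros profile_kernel_tendsto\<close>)
qed

text \<open>The right-hand side is the form of the Green potential that can be differentiated term by term.\<close>

lemma profile_kernel_split:
  assumes f: "continuous_on {0..1/2} f" and t: "t \<in> {0<..1/2}"
  shows "t * integral {0..1/2} (\<lambda>s. profile_kernel t s * f s) =
    integral {0..t} (\<lambda>s. s * f s) + t * integral {t..1/2} f
      + 2 * t * integral {0..1/2} (\<lambda>s. s * f s)"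
proof -
  let ?m = "\<lambda>s. s * f s"
  have cont: "continuous_on {0..t} ?m" "continuous_on {t..1/2} f" "continuous_on {0..1/2} ?m"
    using t by (auto intro!: continuous_intros continuous_on_subset[OF f])
  note hi = cont[THEN integrable_continuous_interval, THEN integrable_integral]
  have "((\<lambda>s. (if s \<le> t then s / t else 1) * f s) has_integral (1 / t * integral {0..t} ?m)) {0..t}"
    by (rule has_integral_eq[OF _ has_integral_mult_right[OF hi(1)]]) auto
  moreover have "((\<lambda>s. (if s \<le> t then s / t else 1) * f s) has_integral integral {t..1/2} f) {t..1/2}"
    by (rule has_integral_eq[OF _ hi(2)]) (use t in auto)
  ultimately have "((\<lambda>s. (if s \<le> t then s / t else 1) * f s)
      has_integral (1 / t * integral {0..t} ?m + integral {t..1/2} f)) {0..1/2}"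
    using t by (intro has_integral_combine[where c = t]) auto
  from has_integral_add[OF this has_integral_mult_right[OF hi(3), of 2]]
  have "((\<lambda>s. profile_kernel t s * f s) has_integral
     (1 / t * integral {0..t} ?m + integral {t..1/2} f + 2 * integral {0..1/2} ?m)) {0..1/2}"
    by (simp add: profile_kernel_def algebra_simps)
  then show ?thesis using t by (simp add: integral_unique algebra_simps)
qed

text \<open>The barrier is \<open>v = 6 r\<^sup>2 - 3 r\<^sup>3\<close>, where \<open>r = sqrt (2 t)\<close>. It satisfies both boundary conditions
  and \<open>- v'' = 9 / r\<close> in the variable \<open>t\<close>, and its profile is \<open>12 - 6 r\<close>. The source is unbounded
  at \<open>0\<close>, so the integral is evaluated from antiderivatives that are continuous up to \<open>0\<close>.\<close>

lemma profile_kernel_barrier: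
  assumes t: "t \<in> {0..1/2}"
  shows "((\<lambda>s. profile_kernel t s * (9 / sqrt (2 * s))) has_integral (12 - 6 * sqrt (2 * t))) {0..1/2}"
proof -
  have sq: "x / sqrt (2 * x) = sqrt (2 * x) / 2" if "x > 0" for x :: real
    using that by (simp add: field_simps)
  have d1: "((\<lambda>s. 9 * sqrt (2 * s)) has_real_derivative 9 / sqrt (2 * x)) (at x)" if "x > 0" for x
    using that by (auto intro!: derivative_eq_intros simp: field_simps)
  have d2: "((\<lambda>s. 3 * s * sqrt (2 * s)) has_real_derivative x * (9 / sqrt (2 * x))) (at x)" if "x > 0" for x
    using that by (auto intro!: derivative_eq_intros simp: field_simps)
  have c1: "continuous_on {a..1/2} (\<lambda>s. 9 * sqrt (2 * s))" for a :: real
    by (intro continuous_intros)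
  have c2: "continuous_on {0..b} (\<lambda>s. 3 * s * sqrt (2 * s))" for b :: real
    by (intro continuous_intros)
  have hi1: "((\<lambda>s. 9 / sqrt (2 * s)) has_integral (9 - 9 * sqrt (2 * a))) {a..1/2}" if "a \<in> {0..1/2}" for a
    using fundamental_theorem_of_calculus_interior[OF _ c1, of a "\<lambda>s. 9 / sqrt (2 * s)"] that d1
    by (simp add: has_real_derivative_iff_has_vector_derivative)
  have hi2: "((\<lambda>s. s * (9 / sqrt (2 * s))) has_integral (3 * b * sqrt (2 * b))) {0..b}" if "b \<in> {0..1/2}" for b
    using fundamental_theorem_of_calculus_interior[OF _ c2, of b "\<lambda>s. s * (9 / sqrt (2 * s))"] that d2
    by (simp add: has_real_derivative_iff_has_vector_derivative)
  have hi3: "((\<lambda>s. 2 * (s * (9 / sqrt (2 * s)))) has_integral 3) {0..1/2}"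
    using has_integral_mult_right[OF hi2[of "1/2"], of 2] by simp
  have "((\<lambda>s. (if s \<le> t then s / t else 1) * (9 / sqrt (2 * s))) has_integral (9 - 6 * sqrt (2 * t))) {0..1/2}"
  proof (cases "t = 0")
    case True
    have "((\<lambda>s. (if s \<le> t then s / t else 1) * (9 / sqrt (2 * s))) has_integral (9 - 9 * sqrt (2 * 0))) {0..1/2}"
      by (rule has_integral_spike_finite[OF _ _ hi1, of "{0}"]) (use True in auto)
    then show ?thesis using True by simp
  next
    case False
    then have t0: "t > 0" using t by auto
    have "((\<lambda>s. (if s \<le> t then s / t else 1) * (9 / sqrt (2 * s))) has_integral (1 / t * (3 * t * sqrt (2 * t)))) {0..t}"
      by (rule has_integral_eq[OF _ has_integral_mult_right[OF hi2]]) (use t in auto)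
    moreover have "((\<lambda>s. (if s \<le> t then s / t else 1) * (9 / sqrt (2 * s))) has_integral (9 - 9 * sqrt (2 * t))) {t..1/2}"
      by (rule has_integral_eq[OF _ hi1]) (use t t0 in auto)
    ultimately have "((\<lambda>s. (if s \<le> t then s / t else 1) * (9 / sqrt (2 * s)))
      has_integral (1 / t * (3 * t * sqrt (2 * t)) + (9 - 9 * sqrt (2 * t)))) {0..1/2}"
      using t by (intro has_integral_combine[where c = t]) auto
    then show ?thesis using t0 by simp
  qed
  from has_integral_add[OF this hi3] show ?thesis
    by (simp add: profile_kernel_def algebra_simps)
qed

text \<open>For \<open>lam = 9\<close> the difference of the two sides is \<open>9 (1 - r)\<^sup>2 (2 - r) / (2 r)\<close> with
  \<open>r = sqrt (2 s)\<close>. The barrier \<open>c (r\<^sup>2 - r\<^sup>3 / 2)\<close> satisfies the inequality at \<open>r = 1\<close> iff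
  \<open>lam \<le> 3 c - c\<^sup>2 / 4\<close>; this bound is largest, namely \<open>9\<close>, at \<open>c = 6\<close>.\<close>

lemma barrier_inequality:
  assumes "lam \<le> 9" "s \<in> {0<..1/2}"
  shows "(12 - 6 * sqrt (2 * s))\<^sup>2 / 8 + lam / 2 \<le> 9 / sqrt (2 * s)"
proof -
  define r where "r = sqrt (2 * s)"
  have r: "0 < r" "r \<le> 1" using assms by (auto simp: r_def)
  have "0 \<le> (1 - r)\<^sup>2 * (2 - r)" using r by simp
  then have "((12 - 6 * r)\<^sup>2 / 8 + 9 / 2) * r \<le> 9"
    by (simp add: power2_eq_square field_simps)
  moreover have "((12 - 6 * r)\<^sup>2 / 8 + lam / 2) * r \<le> ((12 - 6 * r)\<^sup>2 / 8 + 9 / 2) * r"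
    using r assms by (intro mult_right_mono) auto
  ultimately have "((12 - 6 * r)\<^sup>2 / 8 + lam / 2) * r \<le> 9"
    by (rule order_trans[rotated])
  then show ?thesis
    unfolding r_def[symmetric] using r by (simp add: pos_le_divide_eq)
qed

section \<open>Monotone iteration\<close>

definition profile_source :: "real \<Rightarrow> (real \<Rightarrow> real) \<Rightarrow> real \<Rightarrow> real" where
  "profile_source lam p s = (p s)\<^sup>2 / 8 + lam / 2"

primrec profile_iterate :: "real \<Rightarrow> nat \<Rightarrow> real \<Rightarrow> real" where
  "profile_iterate lam 0 = (\<lambda>t. 0)"
| "profile_iterate lam (Suc n) =
     (\<lambda>t. integral {0..1/2} (\<lambda>s. profile_kernel t s * profile_source lam (profile_iterate lam n) s))"

lemma profile_source_continuous:
  "continuous_on S p \<Longrightarrow> continuous_on S (profile_source lam p)"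
  unfolding profile_source_def by (intro continuous_intros) auto

lemma profile_source_mono:
  "0 \<le> p s \<Longrightarrow> p s \<le> q s \<Longrightarrow> profile_source lam p s \<le> profile_source lam q s"
  unfolding profile_source_def by (simp add: power_mono)

text \<open>The barrier profile dominates its own image under the integral operator, which is
  monotone on nonnegative functions, so it
  dominates every iterate that starts from \<open>0\<close>.\<close>

lemma profile_iterate_bounds:
  assumes lam: "0 \<le> lam" "lam \<le> 9"
  shows "continuous_on {0..1/2} (profile_iterate lam n) \<and>
    (\<forall>t\<in>{0..1/2}. 0 \<le> profile_iterate lam n t \<and> profile_iterate lam n t \<le> 12 - 6 * sqrt (2 * t))"
proof (induction n)
  case 0
  have "6 * sqrt (2 * t) \<le> 12" if "t \<in> {0..1/2}" for t :: real
    using real_sqrt_le_mono[of "2 * t" 1] that by (auto simp del: real_sqrt_le_iff real_sqrt_le_1_iff)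
  then show ?case by simp
next
  case (Suc n)
  let ?p = "profile_iterate lam n" and ?f = "profile_source lam (profile_iterate lam n)"
  have p: "0 \<le> ?p s" "?p s \<le> 12 - 6 * sqrt (2 * s)" if "s \<in> {0..1/2}" for s
    using Suc that by auto
  have int: "(\<lambda>s. profile_kernel t s * ?f s) integrable_on {0..1/2}" if "t \<in> {0..1/2}" for t
    using Suc that by (intro profile_kernel_integrable profile_source_continuous) auto
  have f_nonneg: "0 \<le> ?f s" for s
    using lam by (simp add: profile_source_def)
  have "?f s \<le> 12\<^sup>2 / 8 + lam / 2" if s: "s \<in> {0..1/2}" for s
  proof -
    have "0 \<le> sqrt (2 * s)" using s by simp
    then have "?p s \<le> 12" using p[OF s] by linarith
    then have "(?p s)\<^sup>2 \<le> 12\<^sup>2" using p[OF s] by (intro power_mono)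
    then show ?thesis by (simp add: profile_source_def)
  qed
  then have "continuous_on {0..1/2} (profile_iterate lam (Suc n))"
    unfolding profile_iterate.simps using int f_nonneg
    by (intro profile_integral_continuous) auto
  moreover have "0 \<le> profile_iterate lam (Suc n) t" if t: "t \<in> {0..1/2}" for t
    using profile_kernel_bounds(1)[OF t] f_nonneg by (auto intro!: integral_nonneg int t)
  moreover have "profile_iterate lam (Suc n) t \<le> 12 - 6 * sqrt (2 * t)" if t: "t \<in> {0..1/2}" for t
  proof -
    have le: "profile_kernel t s * ?f s \<le> profile_kernel t s * (9 / sqrt (2 * s))"
      if s: "s \<in> {0..1/2}" for s
    (* At s = 0 the source of the barrier takes the default value 9 / 0 = 0, but the kernel is 0. *)
    proof (cases "s = 0")
      case True
      then show ?thesis using t by (simp add: profile_kernel_def)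
    next
      case False
      have "?f s \<le> profile_source lam (\<lambda>s. 12 - 6 * sqrt (2 * s)) s"
        using p[OF s] by (intro profile_source_mono)
      also have "\<dots> \<le> 9 / sqrt (2 * s)"
        unfolding profile_source_def using lam s False by (intro barrier_inequality) auto
      finally show ?thesis
        using profile_kernel_bounds(1)[OF t s] by (rule mult_left_mono)
    qed
    show ?thesis
      using has_integral_le[OF integrable_integral[OF int[OF t]] profile_kernel_barrier[OF t] le]
      by simp
  qed
  ultimately show ?case by blast
qed

lemma profile_iterate_mono:
  assumes lam: "0 \<le> lam" "lam \<le> 9"
  shows "t \<in> {0..1/2} \<Longrightarrow> profile_iterate lam n t \<le> profile_iterate lam (Suc n) t"
proof (induction n arbitrary: t)
  case 0
  then show ?case using profile_iterate_bounds[OF lam, of "Suc 0"] by simp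
next
  case (Suc n)
  have int: "(\<lambda>s. profile_kernel t s * profile_source lam (profile_iterate lam k) s) integrable_on {0..1/2}" for k
    using profile_iterate_bounds[OF lam] Suc.prems
    by (intro profile_kernel_integrable profile_source_continuous) auto
  have "profile_kernel t s * profile_source lam (profile_iterate lam n) s
      \<le> profile_kernel t s * profile_source lam (profile_iterate lam (Suc n)) s"
    if s: "s \<in> {0..1/2}" for s
    using profile_kernel_bounds(1)[OF Suc.prems s] profile_iterate_bounds[OF lam, of n] s
      Suc.IH[OF s] by (intro mult_left_mono profile_source_mono) auto
  then have "integral {0..1/2} (\<lambda>s. profile_kernel t s * profile_source lam (profile_iterate lam n) s)
     \<le> integral {0..1/2} (\<lambda>s. profile_kernel t s * profile_source lam (profile_iterate lam (Suc n)) s)"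
    by (intro integral_le int)
  then show ?case by (simp only: profile_iterate.simps)
qed

text \<open>Monotone convergence passes the iteration to its pointwise limit. The limit inherits continuity
  from the integral that represents it.\<close>

lemma profile_fixed_point:
  assumes lam: "0 \<le> lam" "lam \<le> 9"
  obtains p where "continuous_on {0..1/2} p"
    and "\<And>t. t \<in> {0..1/2} \<Longrightarrow> p t = integral {0..1/2} (\<lambda>s. profile_kernel t s * profile_source lam p s)"
proof -
  let ?p = "profile_iterate lam"
  have bounds: "0 \<le> ?p n t" "?p n t \<le> 12" if t: "t \<in> {0..1/2}" for n t
  proof -
    have "0 \<le> sqrt (2 * t)" using t by simp
    moreover have "?p n t \<le> 12 - 6 * sqrt (2 * t)"
      using profile_iterate_bounds[OF lam, of n] t by blast
    ultimately show "?p n t \<le> 12" by linarith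
    show "0 \<le> ?p n t" using profile_iterate_bounds[OF lam, of n] t by blast
  qed
  define p where "p t = lim (\<lambda>n. ?p n t)" for t
  have conv: "(\<lambda>n. ?p n t) \<longlonglongrightarrow> p t" if t: "t \<in> {0..1/2}" for t
  proof -
    have "incseq (\<lambda>n. ?p n t)"
      using profile_iterate_mono[OF lam t] by (rule incseq_SucI)
    then obtain L where "(\<lambda>n. ?p n t) \<longlonglongrightarrow> L"
      using incseq_convergent[of "\<lambda>n. ?p n t" 12] bounds(2)[OF t] by blast
    then show ?thesis unfolding p_def by (simp add: limI)
  qed
  have p_bounds: "0 \<le> p t" "p t \<le> 12" if t: "t \<in> {0..1/2}" for t
    using LIMSEQ_le_const[OF conv[OF t], of 0] LIMSEQ_le_const2[OF conv[OF t], of 12] bounds[OF t] by auto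
  have fix_p: "(\<lambda>s. profile_kernel t s * profile_source lam p s) integrable_on {0..1/2} \<and>
     p t = integral {0..1/2} (\<lambda>s. profile_kernel t s * profile_source lam p s)"
    if t: "t \<in> {0..1/2}" for t
  proof -
    let ?f = "\<lambda>n s. profile_kernel t s * profile_source lam (?p n) s"
    have "(\<lambda>s. profile_kernel t s * profile_source lam p s) integrable_on {0..1/2} \<and>
      (\<lambda>n. integral {0..1/2} (?f n)) \<longlonglongrightarrow> integral {0..1/2} (\<lambda>s. profile_kernel t s * profile_source lam p s)"
    proof (rule monotone_convergence_increasing)
      show "?f n integrable_on {0..1/2}" for n
        using profile_iterate_bounds[OF lam] t
        by (intro profile_kernel_integrable profile_source_continuous) auto
      show "?f n s \<le> ?f (Suc n) s" if s: "s \<in> {0..1/2}" for n s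
        by (intro mult_left_mono profile_source_mono profile_kernel_bounds t s bounds
            profile_iterate_mono lam)
      show "(\<lambda>n. ?f n s) \<longlonglongrightarrow> profile_kernel t s * profile_source lam p s" if s: "s \<in> {0..1/2}" for s
        unfolding profile_source_def by (intro tendsto_intros conv s) auto
      have "norm (integral {0..1/2} (?f n)) \<le> 12" for n
        using bounds[OF t, of "Suc n"] by simp
      then show "bounded (range (\<lambda>n. integral {0..1/2} (?f n)))"
        by (auto simp: bounded_iff)
    qed
    moreover have "(\<lambda>n. integral {0..1/2} (?f n)) \<longlonglongrightarrow> p t"
      using LIMSEQ_Suc[OF conv[OF t]] by simp
    ultimately show ?thesis using LIMSEQ_unique by blast
  qed
  have "profile_source lam p s \<le> 12\<^sup>2 / 8 + lam / 2" if s: "s \<in> {0..1/2}" for s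
    using power_mono[OF p_bounds(2)[OF s] p_bounds(1)[OF s], of 2] by (simp add: profile_source_def)
  moreover have "0 \<le> profile_source lam p s" for s
    using lam by (simp add: profile_source_def)
  ultimately have "continuous_on {0..1/2}
      (\<lambda>t. integral {0..1/2} (\<lambda>s. profile_kernel t s * profile_source lam p s))"
    using fix_p by (intro profile_integral_continuous) auto
  then have "continuous_on {0..1/2} p"
    using fix_p by (subst continuous_on_cong[OF refl]) auto
  then show ?thesis using that fix_p by blast
qed

text \<open>With \<open>v = t p\<close> for a fixed point \<open>p\<close>, the function \<open>w r = - v (r\<^sup>2 / 2)\<close> is a solution; the factor
  \<open>r\<close> from the chain rule gives the limit \<open>0\<close> of \<open>w'\<close>, since \<open>v'\<close> is bounded.\<close>

lemma solvable_if_le: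
  assumes lam: "0 \<le> lam" "lam \<le> 9"
  shows "N_solvable lam"
proof -
  obtain p where p: "continuous_on {0..1/2} p" and
    fix_p: "\<And>t. t \<in> {0..1/2} \<Longrightarrow> p t = integral {0..1/2} (\<lambda>s. profile_kernel t s * profile_source lam p s)"
    using profile_fixed_point[OF lam] by blast
  define F where "F = profile_source lam p"
  have F: "continuous_on {0..1/2} F"
    unfolding F_def by (rule profile_source_continuous[OF p])
  have sF: "continuous_on {0..1/2} (\<lambda>s. s * F s)"
    by (intro continuous_intros F)
  define m where "m = integral {0..1/2} (\<lambda>s. s * F s)"
  define g where "g t = integral {t..1/2} F + 2 * m" for t
  define v where "v t = integral {0..t} (\<lambda>s. s * F s) + t * integral {t..1/2} F + 2 * t * m" for t
  have v_eq: "v t = t * p t" if "t \<in> {0<..1/2}" for t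
    using profile_kernel_split[OF F that] fix_p[of t] that by (simp add: v_def m_def F_def)
  have dg: "(g has_real_derivative - F t) (at t within {0..1/2})" if "t \<in> {0..1/2}" for t
    unfolding g_def using that
    by (auto intro!: derivative_eq_intros integral_has_real_derivative'[OF F])
  have dv: "(v has_real_derivative g t) (at t within {0..1/2})" if "t \<in> {0..1/2}" for t
    unfolding v_def g_def using that
    by (auto intro!: derivative_eq_intros integral_has_real_derivative[OF sF]
        integral_has_real_derivative'[OF F])
  define \<tau> where "\<tau> r = r\<^sup>2 / 2" for r :: real
  have \<tau>_in: "\<tau> r \<in> {0..1/2}" if "r \<in> {0..1}" for r
    using that by (auto simp: \<tau>_def power_le_one)
  have d\<tau>: "(\<tau> has_real_derivative r) (at r within S)" for r S
    unfolding \<tau>_def by (auto intro!: derivative_eq_intros)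
  have chain: "((\<lambda>r. h (\<tau> r)) has_real_derivative h' * r) (at r within S)"
    if "(h has_real_derivative h') (at (\<tau> r) within {0..1/2})" "S \<subseteq> {0..1}" for h h' r S
  proof -
    have "\<tau> ` S \<subseteq> {0..1/2}" using \<tau>_in that(2) by blast
    from DERIV_image_chain[OF DERIV_subset[OF that(1) this] d\<tau>] show ?thesis by (simp add: o_def)
  qed
  have \<tau>_cont: "continuous_on S \<tau>" for S
    unfolding \<tau>_def by (intro continuous_intros) auto
  have g_cont: "continuous_on {0..1/2} g"
    by (rule DERIV_continuous_on[OF dg])
  have comp: "continuous_on S (\<lambda>r. h (\<tau> r))" if "continuous_on {0..1/2} h" "S \<subseteq> {0..1}" for h :: "real \<Rightarrow> real" and S
    using that \<tau>_in by (intro continuous_on_compose2[OF that(1) \<tau>_cont]) blast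
  define w where "w r = - v (\<tau> r)" for r
  define w' where "w' r = - r * g (\<tau> r)" for r
  define w'' where "w'' r = - g (\<tau> r) + r\<^sup>2 * F (\<tau> r)" for r
  have "C2_on_with {a..b} w w' w''" if "0 < a" "b \<le> 1" for a b
  proof -
    have S: "{a..b} \<subseteq> {0..1}" using that by auto
    have "(w has_real_derivative w' r) (at r within {a..b})"
      and "(w' has_real_derivative w'' r) (at r within {a..b})" if "r \<in> {a..b}" for r
    proof -
      have r: "\<tau> r \<in> {0..1/2}" using \<tau>_in S that by blast
      show "(w has_real_derivative w' r) (at r within {a..b})"
        unfolding w_def w'_def by (auto intro!: derivative_eq_intros chain[OF dv[OF r] S])
      show "(w' has_real_derivative w'' r) (at r within {a..b})"
        unfolding w'_def w''_def
        by (auto intro!: derivative_eq_intros chain[OF dg[OF r] S] simp: power2_eq_square)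
    qed
    moreover have "continuous_on {a..b} w''"
      unfolding w''_def by (intro continuous_intros comp F g_cont S)
    ultimately show ?thesis by (auto simp: C2_on_with_def)
  qed
  moreover have "r\<^sup>2 * w'' r - r * w' r = lam / 2 * r ^ 4 + (w r)\<^sup>2 / 2" if r: "r \<in> {0<..1}" for r
  proof -
    have "\<tau> r \<in> {0<..1/2}" using r by (auto simp: \<tau>_def power_le_one)
    then have w_r: "w r = - (r\<^sup>2 / 2 * p (\<tau> r))" by (simp add: w_def v_eq) (simp add: \<tau>_def)
    show ?thesis
      unfolding w_r
      by (simp add: w''_def w'_def F_def profile_source_def power2_eq_square power4_eq_xxxx field_simps)
  qed
  moreover have "(w' \<longlongrightarrow> 0) (at_right 0)"
  proof -
    have "continuous_on {0..1} w'"
      unfolding w'_def by (intro continuous_intros comp g_cont) auto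
    then have "(w' \<longlongrightarrow> w' 0) (at 0 within {0..1})"
      by (simp add: continuous_on)
    then show ?thesis by (simp add: at_within_Icc_at_right w'_def)
  qed
  moreover have "w 1 = w' 1"
    by (simp add: w_def w'_def \<tau>_def v_def g_def m_def)
  ultimately have "solves_N lam w"
    unfolding solves_N_def by blast
  then show ?thesis unfolding N_solvable_def by blast
qed

section \<open>The critical parameter\<close>

theorem proposition4p2:
  fixes lam0 :: real
  assumes "lam0 > 0"
    and "\<And>lam. 0 \<le> lam \<Longrightarrow> lam < lam0 \<Longrightarrow> N_solvable lam"
    and "\<And>lam. lam > lam0 \<Longrightarrow> \<not> N_solvable lam"
  shows "9 \<le> lam0 \<and> lam0 \<le> 128 / 11"
proof
  show "9 \<le> lam0"
    using assms(3)[of 9] solvable_if_le[of 9] by (auto simp: not_less[symmetric])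
  show "lam0 \<le> 128 / 11"
  proof (rule dense_le_bounded[OF assms(1)])
    fix lam assume "0 < lam" "lam < lam0"
    then show "lam \<le> 128 / 11"
      using assms(2)[of lam] solvable_imp_le[of lam] by simp
  qed
qed

end
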